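(* Let $\mathbf{c}=(c_0,c_1,\ldots)$ be a sequence of numbers such that the unique sequence $P_n(y)$, $n\ge 0$, of monic polynomials orthogonal with respect to $\mathbf{c}$ exists, and let $(s_n)_{n\ge 0}$, $(t_n)_{n\ge 1}$ be the coefficient sequences in the three-term recurrence $P_0(y)=1$, $P_1(y)=y+s_0$, $P_{n+1}(y)=(y+s_n)P_n(y)-t_nP_{n-1}(y)$ $(n\ge 1)$. Let $\alpha$ be a constant and define $\mathbf{b}=(b_0,b_1,\ldots)$ by $b_0:=\alpha$ and $b_k:=c_{k-1}$ for $k\ge 1$. Then for all $n\ge 2$, $$\frac{H_{n+1}(b_k)}{H_n(c_k)} = -s_n\frac{H_n(b_k)}{H_{n-1}(c_k)}-t_n\frac{H_{n-1}(b_k)}{H_{n-2}(c_k)}.$$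
   Context: For a sequence $(a_k)_{k\ge 0}$ and $n\ge 0$, $H_n(a_k):=\det(a_{i+j})_{0\le i,j\le n}$ denotes the $(n+1)\times(n+1)$ Hankel determinant. Given $\mathbf{c}=(c_0,c_1,\ldots)$, let $L$ be the linear functional on polynomials with $L(y^k)=c_k$ for all $k\ge0$. The monic orthogonal polynomials with respect to $\mathbf{c}$ are the monic polynomials $P_n(y)$ of degree $n$ with $L(P_mP_n)=\zeta_n\delta_{m,n}$ and $\zeta_n\ne 0$; they exist (uniquely) if and only if $H_n(c_k)\neq0$ for all $n\ge0$, and they satisfy a three-term recurrence of the form stated in the claim. *)

theory Defs
  imports "Jordan_Normal_Form.Determinant" "HOL-Computational_Algebra.Polynomial"
begin

text \<open>The index \<open>n\<close> gives a determinant of order \<open>n + 1\<close>.\<close>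

definition hankel_det :: "nat \<Rightarrow> (nat \<Rightarrow> 'a::comm_ring_1) \<Rightarrow> 'a" where
  "hankel_det n a = det (mat (n + 1) (n + 1) (\<lambda>(i, j). a (i + j)))"

definition moment_functional :: "(nat \<Rightarrow> 'a::comm_ring_1) \<Rightarrow> 'a poly \<Rightarrow> 'a" where
  "moment_functional c p = (\<Sum>k\<le>degree p. Polynomial.coeff p k * c k)"

definition monic_orthogonal_polys ::
    "(nat \<Rightarrow> 'a::field) \<Rightarrow> (nat \<Rightarrow> 'a poly) \<Rightarrow> bool" where
  "monic_orthogonal_polys c P \<longleftrightarrow>
     (\<forall>n. degree (P n) = n \<and> lead_coeff (P n) = 1) \<and>
     (\<exists>\<zeta>. (\<forall>n. \<zeta> n \<noteq> 0) \<and>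
          (\<forall>m n. moment_functional c (P m * P n) = (if m = n then \<zeta> n else 0)))"

text \<open>The next facts show that the formula above is the unique linear functional with
  \<open>L(y\<^sup>k) = c\<^sub>k\<close> for all \<open>k\<close>.\<close>

lemma moment_functional_altdef:
  assumes "degree p \<le> N"
  shows "moment_functional c p = (\<Sum>k\<le>N. Polynomial.coeff p k * c k)"
  unfolding moment_functional_def
  by (rule sum.mono_neutral_left) (use assms in \<open>auto simp: coeff_eq_0\<close>)

lemma moment_functional_add:
  "moment_functional c (p + q) = moment_functional c p + moment_functional c q"
proof -
  define N where "N = max (degree p) (degree q)"
  have "degree (p + q) \<le> N" "degree p \<le> N" "degree q \<le> N"
    by (auto simp: N_def degree_add_le_max)
  then show ?thesis
    by (simp add: moment_functional_altdef[of _ N] sum.distrib distrib_right)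
qed

lemma moment_functional_smult:
  "moment_functional c (Polynomial.smult a p) = a * moment_functional c p"
  by (simp add: moment_functional_altdef[of _ "degree p"] sum_distrib_left mult.assoc
      degree_smult_le)

lemma moment_functional_monom:
  "moment_functional c (Polynomial.monom 1 k) = c k"
  by (simp add: moment_functional_altdef[of _ k] degree_monom_le if_distrib[of "\<lambda>x. x * _"]
      cong: if_cong)

lemma moment_functional_unique:
  assumes add: "\<And>p q. L (p + q) = L p + L q"
    and smult: "\<And>a p. L (Polynomial.smult a p) = a * L p"
    and monom: "\<And>k. L (Polynomial.monom 1 k) = c k"
  shows "L = moment_functional c"
proof
  fix p
  have L0: "L 0 = 0" using smult[of 0 0] by simp
  have Lsum: "L (\<Sum>i\<in>A. f i) = (\<Sum>i\<in>A. L (f i))" if "finite A" for A :: "nat set" and f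
    using that by (induction A rule: finite_induct) (auto simp: L0 add)
  have "L (\<Sum>k\<le>degree p. Polynomial.smult (Polynomial.coeff p k) (Polynomial.monom 1 k))
      = moment_functional c p"
    by (simp only: Lsum[OF finite_atMost] smult monom moment_functional_def)
  then show "L p = moment_functional c p"
    by (simp add: smult_monom poly_as_sum_of_monoms)
qed

end

theory Submission
  imports Defs
begin

text \<open>Let \<open>L\<close> and \<open>M\<close> be the moment functionals of \<open>c\<close> and \<open>b\<close>, so that \<open>M (y p) = L p\<close>.
  Replacing the last column of a Hankel matrix by the combination of its columns with the
  coefficients of the monic polynomial \<open>P\<^sub>n\<close> does not change the determinant. For \<open>c\<close> the new
  column has entries \<open>L (y\<^sup>i P\<^sub>n)\<close> and only the last one survives, whence
  \<open>H\<^sub>n(c) = \<zeta>\<^sub>n H\<^sub>n\<^sub>-\<^sub>1(c) \<noteq> 0\<close>. For \<open>b\<close> the entries are \<open>M (y\<^sup>i P\<^sub>n)\<close> and only the first one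
  survives, whence \<open>H\<^sub>n(b) = (-1)\<^sup>n M(P\<^sub>n) H\<^sub>n\<^sub>-\<^sub>1(c)\<close>. Applying \<open>M\<close> to the three-term recurrence,
  where \<open>M (y P\<^sub>n) = L P\<^sub>n = 0\<close>, gives the claim.\<close>

lemma moment_functional_0: "moment_functional c 0 = 0"
  by (simp add: moment_functional_def)

lemma moment_functional_diff:
  "moment_functional c (p - q) = moment_functional c p - moment_functional c q"
  using moment_functional_add[of c p "Polynomial.smult (-1) q"]
  by (simp only: moment_functional_smult) simp

text \<open>The right-hand side is row \<open>i\<close> of the Hankel matrix applied to the
  coefficient vector of \<open>p\<close>; this links column operations to the functional.\<close>

lemma moment_functional_monom_mult:
  "moment_functional c (Polynomial.monom 1 i * p) =
     (\<Sum>k\<le>degree p. Polynomial.coeff p k * c (i + k))"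
proof -
  have "moment_functional c (Polynomial.monom 1 i * p) =
      (\<Sum>k\<le>degree p + i. Polynomial.coeff (Polynomial.monom 1 i * p) k * c k)"
    by (rule moment_functional_altdef)
       (metis add.commute add_left_mono degree_monom_le degree_mult_le le_trans)
  also have "\<dots> = (\<Sum>k\<in>{0 + i..degree p + i}. Polynomial.coeff p (k - i) * c k)"
    by (rule sum.mono_neutral_cong_right) (auto simp: coeff_monom_mult)
  also have "\<dots> = (\<Sum>k\<in>{0..degree p}. Polynomial.coeff p k * c (i + k))"
    by (subst sum.shift_bounds_cl_nat_ivl) (simp add: add.commute)
  finally show ?thesis by (simp add: atMost_atLeast0)
qed

lemma moment_functional_shift:
  assumes "\<And>k. b (Suc k) = c k"
  shows "moment_functional b (Polynomial.monom 1 (Suc i) * p) =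
    moment_functional c (Polynomial.monom 1 i * p)"
  by (simp add: moment_functional_monom_mult assms)

text \<open>Indexed by the order, unlike \<open>hankel_det\<close>, so that the empty matrix with
  determinant 1 can start inductions.\<close>

definition hankel_mat :: "nat \<Rightarrow> (nat \<Rightarrow> 'a) \<Rightarrow> 'a mat" where
  "hankel_mat n a = mat n n (\<lambda>(i, j). a (i + j))"

lemma hankel_mat_carrier: "hankel_mat n a \<in> carrier_mat n n"
  by (simp add: hankel_mat_def)

lemma hankel_det_eq: "hankel_det n a = det (hankel_mat (Suc n) a)"
  by (simp add: hankel_det_def hankel_mat_def)

text \<open>Used twice: with \<open>r = n\<close> for the moments c and with \<open>r = 0\<close>
  for the prepended sequence b.\<close>

lemma det_hankel_mat_single:
  fixes a :: "nat \<Rightarrow> 'a::comm_ring_1"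
  assumes deg: "degree p = n" and lc: "lead_coeff p = 1" and r: "r \<le> n"
    and zero: "\<And>i. i \<le> n \<Longrightarrow> i \<noteq> r \<Longrightarrow>
      moment_functional a (Polynomial.monom 1 i * p) = 0"
  shows "det (hankel_mat (Suc n) a) =
    (-1) ^ (r + n) * moment_functional a (Polynomial.monom 1 r * p) *
    det (mat_delete (hankel_mat (Suc n) a) r n)"
proof -
  define H where "H = hankel_mat (Suc n) a"
  \<comment> \<open>Right multiplication by \<open>U\<close> keeps every column except the last,
    which becomes the combination given by \<open>p\<close>. Since \<open>p\<close> is monic,
    \<open>U\<close> is upper unitriangular and the determinant is unchanged.\<close>
  define U where "U = mat (Suc n) (Suc n)
    (\<lambda>(i, j). if j = n then Polynomial.coeff p i else if i = j then 1 else 0)"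
  define v where "v i = moment_functional a (Polynomial.monom 1 i * p)" for i
  have H: "H \<in> carrier_mat (Suc n) (Suc n)" by (simp add: H_def hankel_mat_carrier)
  have U: "U \<in> carrier_mat (Suc n) (Suc n)" by (simp add: U_def)
  have "upper_triangular U" by (auto simp: U_def)
  moreover have "U $$ (i, i) = 1" if "i \<le> n" for i
    using that deg lc by (auto simp: U_def)
  ultimately have "det U = 1"
    using U by (subst det_upper_triangular) (auto simp: prod_list_diag_prod)
  then have detHU: "det (H * U) = det H"
    using det_mult[OF H U] by simp
  have HU: "(H * U) $$ (i, j) = (if j = n then v i else H $$ (i, j))"
    if "i \<le> n" "j \<le> n" for i j
  proof -
    have "(H * U) $$ (i, j) = (\<Sum>k\<in>{0..<Suc n}. H $$ (i, k) * U $$ (k, j))"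
      using that H U by (simp add: scalar_prod_def)
    also have "\<dots> = (if j = n then v i else H $$ (i, j))"
    proof (cases "j = n")
      case True
      have "(\<Sum>k\<in>{0..<Suc n}. H $$ (i, k) * U $$ (k, j)) =
          (\<Sum>k\<le>n. Polynomial.coeff p k * a (i + k))"
        using that True by (intro sum.cong) (auto simp: H_def U_def hankel_mat_def mult.commute)
      then show ?thesis
        using True deg by (simp add: v_def moment_functional_monom_mult)
    next
      case False
      have "(\<Sum>k\<in>{0..<Suc n}. H $$ (i, k) * U $$ (k, j)) =
          (\<Sum>k\<in>{0..<Suc n}. if k = j then H $$ (i, k) else 0)"
        using that False by (intro sum.cong) (auto simp: U_def)
      then show ?thesis using that False by (simp add: sum.delta)
    qed
    finally show ?thesis .
  qed
  \<comment> \<open>Column \<open>n\<close> is the only one in which the two matrices can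
    differ.\<close>
  have del: "mat_delete (H * U) r n = mat_delete H r n"
    using H U r by (auto intro!: eq_matI simp: mat_delete_def HU simp del: index_mult_mat(1))
  have "det (H * U) = (\<Sum>i<Suc n. (H * U) $$ (i, n) * cofactor (H * U) i n)"
    using laplace_expansion_column[of "H * U" "Suc n" n] H U by simp
  also have "\<dots> = (\<Sum>i<Suc n. if i = r then v r * cofactor (H * U) r n else 0)"
    using zero by (intro sum.cong) (auto simp: HU v_def simp del: index_mult_mat(1))
  also have "\<dots> = v r * cofactor (H * U) r n"
    using r by (simp add: sum.delta)
  finally show ?thesis
    unfolding detHU cofactor_def del H_def[symmetric] v_def[symmetric] by (simp add: mult_ac)
qed

text \<open>Subtracting the multiple of \<open>P ?d\<close> with the same leading term lowers the
  degree of \<open>q\<close>, so strong induction on the degree applies.\<close>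

lemma monic_orthogonal_polys_lower_degree:
  assumes orth: "monic_orthogonal_polys c P" and "degree q < n"
  shows "moment_functional c (q * P n) = 0"
  using assms(2)
proof (induction "degree q" arbitrary: q rule: less_induct)
  case less
  let ?d = "degree q"
  define r where "r = q - Polynomial.smult (lead_coeff q) (P ?d)"
  have degP: "degree (P ?d) = ?d" and lcP: "Polynomial.coeff (P ?d) ?d = 1"
    using orth unfolding monic_orthogonal_polys_def by metis+
  have "moment_functional c (P ?d * P n) = 0"
    using orth less.prems unfolding monic_orthogonal_polys_def by (metis less_irrefl)
  moreover have "moment_functional c (r * P n) = 0"
  proof (cases "r = 0")
    case True
    then show ?thesis by (simp add: moment_functional_0)
  next
    case False
    have "degree r \<le> ?d"
      unfolding r_def by (rule degree_diff_le) (simp_all add: degP order.trans[OF degree_smult_le])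
    moreover have "Polynomial.coeff r ?d = 0"
      by (simp add: r_def lcP)
    ultimately have "degree r < ?d"
      using False by (metis le_neq_implies_less leading_coeff_0_iff)
    then show ?thesis using less by simp
  qed
  moreover have "q * P n = Polynomial.smult (lead_coeff q) (P ?d * P n) + r * P n"
    by (simp add: r_def algebra_simps)
  ultimately show ?case
    by (simp add: moment_functional_add moment_functional_smult)
qed

lemma monic_orthogonal_polys_monom_lower:
  assumes "monic_orthogonal_polys c P" and "i < n"
  shows "moment_functional c (Polynomial.monom 1 i * P n) = 0"
  using assms by (intro monic_orthogonal_polys_lower_degree) (simp_all add: degree_monom_eq)

text \<open>The monomial differs from \<open>P n\<close> by a polynomial that is zero or of smaller
  degree, so the value equals the norm of \<open>P n\<close>.\<close>

lemma monic_orthogonal_polys_monom_nonzero: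
  assumes orth: "monic_orthogonal_polys c P"
  shows "moment_functional c (Polynomial.monom 1 n * P n) \<noteq> 0"
proof -
  have degP: "degree (P n) = n" and lcP: "Polynomial.coeff (P n) n = 1"
    using orth unfolding monic_orthogonal_polys_def by metis+
  have nz: "moment_functional c (P n * P n) \<noteq> 0"
    using orth unfolding monic_orthogonal_polys_def by metis
  define r where "r = Polynomial.monom 1 n - P n"
  have "moment_functional c (r * P n) = 0"
  proof (cases "r = 0")
    case True
    then show ?thesis by (simp add: moment_functional_0)
  next
    case False
    have "degree r \<le> n"
      unfolding r_def by (rule degree_diff_le) (simp_all add: degP degree_monom_le)
    moreover have "Polynomial.coeff r n = 0"
      by (simp add: r_def lcP)
    ultimately have "degree r < n"
      using False by (metis le_neq_implies_less leading_coeff_0_iff)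
    then show ?thesis by (rule monic_orthogonal_polys_lower_degree[OF orth])
  qed
  moreover have "Polynomial.monom 1 n * P n = r * P n + P n * P n"
    by (simp add: r_def algebra_simps)
  ultimately show ?thesis
    using nz by (simp add: moment_functional_add)
qed

lemma monic_orthogonal_polys_det_hankel_nonzero:
  assumes orth: "monic_orthogonal_polys c P"
  shows "det (hankel_mat n c) \<noteq> 0"
proof (induction n)
  case 0
  then show ?case by (simp add: hankel_mat_def)
next
  case (Suc n)
  have "degree (P n) = n" "lead_coeff (P n) = 1"
    using orth unfolding monic_orthogonal_polys_def by metis+
  then have "det (hankel_mat (Suc n) c) =
      (-1) ^ (n + n) * moment_functional c (Polynomial.monom 1 n * P n) *
      det (mat_delete (hankel_mat (Suc n) c) n n)"
    by (rule det_hankel_mat_single)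
       (use monic_orthogonal_polys_monom_lower[OF orth] in auto)
  moreover have "mat_delete (hankel_mat (Suc n) c) n n = hankel_mat n c"
    by (auto intro!: eq_matI simp: mat_delete_def hankel_mat_def)
  ultimately show ?case
    using Suc monic_orthogonal_polys_monom_nonzero[OF orth] by simp
qed

lemma det_hankel_mat_prepend:
  assumes orth: "monic_orthogonal_polys c P" and b: "\<And>k. b (Suc k) = c k"
  shows "det (hankel_mat (Suc n) b) =
    (-1) ^ n * moment_functional b (P n) * det (hankel_mat n c)"
proof -
  have "degree (P n) = n" "lead_coeff (P n) = 1"
    using orth unfolding monic_orthogonal_polys_def by metis+
  moreover have "moment_functional b (Polynomial.monom 1 i * P n) = 0"
    if "i \<le> n" "i \<noteq> 0" for i
    using that monic_orthogonal_polys_monom_lower[OF orth]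
    by (cases i) (simp_all add: moment_functional_shift[of b c, OF b])
  ultimately have "det (hankel_mat (Suc n) b) =
      (-1) ^ (0 + n) * moment_functional b (Polynomial.monom 1 0 * P n) *
      det (mat_delete (hankel_mat (Suc n) b) 0 n)"
    by (intro det_hankel_mat_single) auto
  \<comment> \<open>Without the first row the index sums start at 1, where b is c shifted by
    one.\<close>
  moreover have "mat_delete (hankel_mat (Suc n) b) 0 n = hankel_mat n c"
    by (auto intro!: eq_matI simp: mat_delete_def hankel_mat_def b)
  ultimately show ?thesis by (simp add: monom_0)
qed

theorem lemma2p5:
  fixes c b s t :: "nat \<Rightarrow> 'a::field"
    and \<alpha> :: 'a
    and P :: "nat \<Rightarrow> 'a poly"
    and n :: nat
  assumes orth: "monic_orthogonal_polys c P"
    and P_0: "P 0 = 1"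
    and P_1: "P 1 = [:s 0, 1:]"
    and P_rec: "\<And>m. m \<ge> 1 \<Longrightarrow>
          P (m + 1) = [:s m, 1:] * P m - Polynomial.smult (t m) (P (m - 1))"
    and b_0: "b 0 = \<alpha>"
    and b_rec: "\<And>k. k \<ge> 1 \<Longrightarrow> b k = c (k - 1)"
    and n: "n \<ge> 2"
  shows "hankel_det (n + 1) b / hankel_det n c =
           - s n * (hankel_det n b / hankel_det (n - 1) c)
           - t n * (hankel_det (n - 1) b / hankel_det (n - 2) c)"
proof -
  let ?M = "moment_functional b"
  have b: "b (Suc k) = c k" for k using b_rec[of "Suc k"] by simp
  \<comment> \<open>Each quotient in the claim is, up to sign, a value of the functional of b,
    because the determinant of c cancels.\<close>
  have ratio: "hankel_det (Suc m) b / hankel_det m c = (-1) ^ Suc m * ?M (P (Suc m))" for m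
    using monic_orthogonal_polys_det_hankel_nonzero[OF orth, of "Suc m"]
    by (simp add: hankel_det_eq det_hankel_mat_prepend[of c P b, OF orth b])
  obtain k where k: "n = Suc (Suc k)"
    using n by (metis add_2_eq_Suc le_Suc_ex)
  have "P (Suc n) = Polynomial.monom 1 (Suc 0) * P n + Polynomial.smult (s n) (P n)
      - Polynomial.smult (t n) (P (Suc k))"
    using P_rec[of n] k by (simp add: monom_Suc monom_0)
  moreover have "?M (Polynomial.monom 1 (Suc 0) * P n) = 0"
    using monic_orthogonal_polys_monom_lower[OF orth, of 0 n] k
    by (simp add: moment_functional_shift[of b c, OF b])
  ultimately have rec: "?M (P (Suc n)) = s n * ?M (P n) - t n * ?M (P (Suc k))"
    by (simp add: moment_functional_diff moment_functional_add moment_functional_smult)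
  \<comment> \<open>Multiplying \<open>rec\<close> by \<open>(-1) ^ Suc n\<close> flips the sign of
    the \<open>s n\<close> term only, as the index in the \<open>t n\<close> term is lower by
    two.\<close>
  show ?thesis
    using ratio[of n] ratio[of "Suc k"] ratio[of k] k rec[unfolded k]
    by (simp add: right_diff_distrib)
qed

end
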